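(* Consider the linear system $\dot{\mathbf x}=\mathbf A\mathbf x+\mathbf B\mathbf u$ with $\mathbf x,\mathbf u\in\mathbb R^n$ and $\mathbf A,\mathbf B\in\mathbb R^{n\times n}$, and assume that $\mathbf B$ has full rank. Let $0<\alpha<1$, let $\mathbf K_1\in\mathbb R^{n\times n}$ be such that $\mathbf A+\mathbf B\mathbf K_1$ is Hurwitz, let $\mathbf K_2=-\mathbf B^{-1}$, and let $\mathbf x_\alpha=\mathbf x\|\mathbf x\|^{\alpha-1}$. Then the feedback control law $$\mathbf u(\mathbf x)=\mathbf K_1\mathbf x+\mathbf K_2\mathbf x_\alpha$$ stabilizes the origin of the closed-loop system in finite time, i.e. the origin is a finite-time-stable equilibrium of the closed-loop system.
   Context: $\|\cdot\|$ is the Euclidean norm, and $\mathbf x_\alpha$ is understood as $\mathbf 0$ at $\mathbf x=\mathbf 0$. Finite-time stability: consider an autonomous system $\dot y=f(y)$ with $f(0)=0$ on a domain $D\subset\mathbb R^n$ containing $0$, and let $\psi^x$ denote the unique right maximal solution starting at $x$. The origin is a finite-time-stable equilibrium if there exist an open neighborhood $\mathcal N\subset D$ of the origin and a function $T:\mathcal N\setminus\{0\}\to(0,\infty)$ such that: (1) for every $x\in\mathcal N\setminus\{0\}$, $\psi^x$ is defined on $[0,T(x))$, $\psi^x(t)\in\mathcal N\setminus\{0\}$ for all $t\in[0,T(x))$, and $\lim_{t\to T(x)}\psi^x(t)=0$; (2) for every open neighborhood $U_\epsilon$ of $0$ there is an open subset $U_\delta$ of $\mathcal N$ containing $0$ such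 that for every $x\in U_\delta\setminus\{0\}$, $\psi^x(t)\in U_\epsilon$ for all $t\in[0,T(x))$. *)

theory Defs
  imports "HOL-Analysis.Analysis"
begin

definition complex_eigenvalue :: "real^'n^'n \<Rightarrow> complex \<Rightarrow> bool" where
  "complex_eigenvalue M l \<longleftrightarrow>
     (\<exists>v :: complex^'n. v \<noteq> 0 \<and> map_matrix complex_of_real M *v v = l *s v)"

definition hurwitz :: "real^'n^'n \<Rightarrow> bool" where
  "hurwitz M \<longleftrightarrow> (\<forall>l. complex_eigenvalue M l \<longrightarrow> Re l < 0)"

(* At x = 0 the scalar factor is irrelevant, so the value there is 0. *)
definition norm_scaled :: "real \<Rightarrow> 'a::real_normed_vector \<Rightarrow> 'a" where
  "norm_scaled \<alpha> x = (norm x powr (\<alpha> - 1)) *\<^sub>R x"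

(* Solutions of y' = f y in D, forward from time 0, on a nondegenerate interval J
   with least element 0: J is [0,b), [0,b] or [0,\<infinity>). The derivative at an
   endpoint contained in J is one-sided. *)
definition forward_solution ::
  "'a::euclidean_space set \<Rightarrow> ('a \<Rightarrow> 'a) \<Rightarrow> 'a \<Rightarrow> real set \<Rightarrow> (real \<Rightarrow> 'a) \<Rightarrow> bool" where
  "forward_solution D f x J y \<longleftrightarrow>
     is_interval J \<and> 0 \<in> J \<and> J \<subseteq> {0..} \<and> J \<noteq> {0} \<and>
     y 0 = x \<and> (\<forall>t\<in>J. y t \<in> D) \<and>
     (\<forall>t\<in>J. (y has_vector_derivative f (y t)) (at t within J))"

definition right_maximal_solution ::
  "'a::euclidean_space set \<Rightarrow> ('a \<Rightarrow> 'a) \<Rightarrow> 'a \<Rightarrow> real set \<Rightarrow> (real \<Rightarrow> 'a) \<Rightarrow> bool" where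
  "right_maximal_solution D f x J y \<longleftrightarrow>
     forward_solution D f x J y \<and>
     (\<forall>J' y'. forward_solution D f x J' y' \<and> J \<subseteq> J' \<and> (\<forall>t\<in>J. y' t = y t) \<longrightarrow> J' = J)"

(* Uniqueness is up to the values of y outside J, which carry no meaning. *)
definition unique_right_maximal_solution ::
  "'a::euclidean_space set \<Rightarrow> ('a \<Rightarrow> 'a) \<Rightarrow> 'a \<Rightarrow> real set \<Rightarrow> (real \<Rightarrow> 'a) \<Rightarrow> bool" where
  "unique_right_maximal_solution D f x J y \<longleftrightarrow>
     right_maximal_solution D f x J y \<and>
     (\<forall>J' y'. right_maximal_solution D f x J' y' \<longrightarrow> J' = J \<and> (\<forall>t\<in>J. y' t = y t))"

(* \<psi> x on J x is the unique right maximal solution starting at x; its existence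
   and uniqueness for every x in D is part of the notion. *)
definition finite_time_stable_origin ::
  "'a::euclidean_space set \<Rightarrow> ('a \<Rightarrow> 'a) \<Rightarrow> bool" where
  "finite_time_stable_origin D f \<longleftrightarrow>
     open D \<and> connected D \<and> 0 \<in> D \<and> f 0 = 0 \<and>
     (\<exists>J \<psi>.
        (\<forall>x\<in>D. unique_right_maximal_solution D f x (J x) (\<psi> x)) \<and>
        (\<exists>N (T :: 'a \<Rightarrow> real).
           open N \<and> 0 \<in> N \<and> N \<subseteq> D \<and> (\<forall>x\<in>N - {0}. 0 < T x) \<and>
           (\<forall>x\<in>N - {0}.
              {0..<T x} \<subseteq> J x \<and>
              (\<forall>t\<in>{0..<T x}. \<psi> x t \<in> N - {0}) \<and>
              (\<psi> x \<longlongrightarrow> 0) (at_left (T x))) \<and>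
           (\<forall>U. open U \<and> 0 \<in> U \<longrightarrow>
              (\<exists>V. open V \<and> V \<subseteq> N \<and> 0 \<in> V \<and>
                 (\<forall>x\<in>V - {0}. \<forall>t\<in>{0..<T x}. \<psi> x t \<in> U)))))"

end

theory Submission
  imports Defs
begin

text \<open>
  The closed-loop field is \<open>L x - norm_scaled \<alpha> x\<close> with \<open>L = A + B K\<^sub>1\<close>. Its second term is radial, so
  the solutions are explicit: if \<open>z' = L z\<close>, \<open>z 0 = x\<close>, then \<open>c(t) z(t)\<close> is a solution as soon as
  \<open>c' = - c^\<alpha> \<bar>z\<bar>^(\<alpha>-1)\<close>, which separates to
  \<open>c^(1-\<alpha>) = 1 - (1-\<alpha>) \<integral>\<^sub>0\<^sup>t \<bar>z\<bar>^(\<alpha>-1)\<close>, cut off at \<open>0\<close>. As \<open>\<bar>z(t)\<bar> \<le> e^(kt) \<bar>x\<bar>\<close>, the right-hand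
  side reaches \<open>0\<close> in finite time whenever \<open>k \<bar>x\<bar>^(1-\<alpha>) < 1\<close>, and then the norm never exceeds its initial
  value. Forward uniqueness holds although the field is not Lipschitz at \<open>0\<close>, because
  \<open>norm_scaled \<alpha>\<close> is monotone, which makes the field one-sided Lipschitz.
\<close>

section \<open>Linear flow and Gronwall estimates\<close>

text \<open>The solution is the exponential series, the sum of t^n / n! times L^n x. It converges
  for all t because the norm of L^n x is at most K^n times that of x.\<close>

lemma linear_ode_solution_exists:
  fixes L :: "'a::euclidean_space \<Rightarrow> 'a"
  assumes "bounded_linear L"
  shows "\<exists>z. z 0 = x \<and> (\<forall>t. (z has_vector_derivative L (z t)) (at t))"
proof -
  interpret L: bounded_linear L by fact
  obtain K where K: "K > 0" "\<And>x. norm (L x) \<le> norm x * K"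
    using L.pos_bounded by blast
  define a where "a = (\<lambda>n. (L ^^ n) x)"
  have a_bound: "norm (a n) \<le> norm x * K ^ n" for n
  proof (induction n)
    case (Suc n)
    have "norm (a (Suc n)) \<le> norm (a n) * K" using K(2)[of "a n"] by (simp add: a_def)
    also have "\<dots> \<le> norm x * K ^ n * K" using Suc K(1) by (intro mult_right_mono) auto
    finally show ?case by (simp add: mult_ac)
  qed (simp add: a_def)
  define s where "s = (\<lambda>t n. (t ^ n / fact n) *\<^sub>R a n)"
  have summ: "summable (s t)" for t :: real
  proof (rule summable_comparison_test')
    show "summable (\<lambda>n. norm x * (inverse (fact n) * (\<bar>t\<bar> * K) ^ n))"
      by (intro summable_mult summable_exp)
    show "norm (s t n) \<le> norm x * (inverse (fact n) * (\<bar>t\<bar> * K) ^ n)" for n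
    proof -
      have "norm (s t n) = \<bar>t\<bar> ^ n / fact n * norm (a n)" by (simp add: s_def power_abs)
      also have "\<dots> \<le> \<bar>t\<bar> ^ n / fact n * (norm x * K ^ n)"
        by (intro mult_left_mono a_bound) auto
      finally show ?thesis by (simp add: field_simps)
    qed
  qed
  define z where "z = (\<lambda>t. \<Sum>n. s t n)"
  have "s 0 = (\<lambda>n. if n = 0 then x else 0)"
    by (auto simp: s_def a_def)
  then have z0: "z 0 = x"
    using suminf_finite[of "{0}" "s 0"] by (simp add: z_def)
  have "(z has_vector_derivative L (z t)) (at t)" for t
    unfolding has_vector_derivative_def
  \<comment> \<open>Each coordinate of \<open>z\<close> is a real power series in t, so termwise
    differentiation of scalar power series applies coordinate by coordinate.\<close>
  proof (subst has_derivative_componentwise_within, intro ballI)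
    fix b :: 'a assume "b \<in> Basis"
    define c where "c = (\<lambda>n. (a n \<bullet> b) / fact n)"
    have sc: "summable (\<lambda>n. c n * y ^ n)" for y
    proof -
      have "summable (\<lambda>n. s y n \<bullet> b)"
        by (rule bounded_linear.summable[OF bounded_linear_inner_left summ])
      moreover have "(\<lambda>n. s y n \<bullet> b) = (\<lambda>n. c n * y ^ n)"
        by (auto simp: s_def c_def)
      ultimately show ?thesis by simp
    qed
    have zc: "z y \<bullet> b = (\<Sum>n. c n * y ^ n)" for y
      unfolding z_def bounded_linear.suminf[OF bounded_linear_inner_left summ]
      by (simp add: s_def c_def mult_ac)
    have "L (z t) \<bullet> b = (\<Sum>n. L (s t n)) \<bullet> b"
      unfolding z_def L.suminf[OF summ] ..
    also have "\<dots> = (\<Sum>n. L (s t n) \<bullet> b)"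
      by (rule bounded_linear.suminf[OF bounded_linear_inner_left L.summable[OF summ]])
    also have "\<dots> = (\<Sum>n. diffs c n * t ^ n)"
    proof -
      \<comment> \<open>Applying \<open>L\<close> turns \<open>a n\<close> into
        \<open>a (Suc n)\<close>; \<open>diffs\<close> shifts the coefficients in the same way, its
        factor n + 1 reducing 1 / (n+1)! to 1 / n!.\<close>
      have "L (s t n) \<bullet> b = diffs c n * t ^ n" for n
        by (simp add: s_def c_def diffs_def a_def L.scaleR field_simps del: of_nat_Suc)
      then show ?thesis by simp
    qed
    finally have "((\<lambda>y. z y \<bullet> b) has_field_derivative L (z t) \<bullet> b) (at t)"
      unfolding zc using termdiffs_strong_converges_everywhere[OF sc] by simp
    then show "((\<lambda>y. z y \<bullet> b) has_derivative (\<lambda>h. (h *\<^sub>R L (z t)) \<bullet> b)) (at t)"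
      by (simp add: has_field_derivative_def mult.commute[of _ "L (z t) \<bullet> b"])
  qed
  with z0 show ?thesis by blast
qed

lemma DERIV_norm_square:
  fixes y :: "real \<Rightarrow> 'a::real_inner"
  assumes "(y has_vector_derivative d) (at t within S)"
  shows "((\<lambda>t. (norm (y t))\<^sup>2) has_real_derivative 2 * (y t \<bullet> d)) (at t within S)"
proof -
  have "((\<lambda>t. y t \<bullet> y t) has_derivative (\<lambda>h. y t \<bullet> (h *\<^sub>R d) + (h *\<^sub>R d) \<bullet> y t)) (at t within S)"
    using assms unfolding has_vector_derivative_def by (intro derivative_intros)
  moreover have "y t \<bullet> (h *\<^sub>R d) + (h *\<^sub>R d) \<bullet> y t = 2 * (y t \<bullet> d) * h" for h
    by (simp add: inner_commute[of d])
  ultimately show ?thesis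
    unfolding has_field_derivative_def power2_norm_eq_inner by (simp only:)
qed

text \<open>The squared norm, weighted by exp (-2kt), has nonpositive derivative. Asking for
  derivatives only in the open interval lets the estimate apply to solutions that are one-sided at
  their initial time.\<close>

lemma gronwall_norm_square:
  fixes y :: "real \<Rightarrow> 'a::real_inner"
  assumes "a \<le> b" and cont: "continuous_on {a..b} y"
    and der: "\<And>t. a < t \<Longrightarrow> t < b \<Longrightarrow> (y has_vector_derivative d t) (at t)"
    and le: "\<And>t. a < t \<Longrightarrow> t < b \<Longrightarrow> y t \<bullet> d t \<le> k * (norm (y t))\<^sup>2"
  shows "norm (y b) \<le> exp (k * (b - a)) * norm (y a)"
proof -
  define v where "v = (\<lambda>t. exp (- 2 * k * t) * (norm (y t))\<^sup>2)"
  have "v b \<le> v a"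
  proof (rule DERIV_nonpos_imp_decreasing_open[OF \<open>a \<le> b\<close>])
    fix t assume t: "a < t" "t < b"
    have "(v has_real_derivative
        exp (- 2 * k * t) * (2 * (y t \<bullet> d t)) + (exp (- 2 * k * t) * (- 2 * k)) * (norm (y t))\<^sup>2) (at t)"
    proof -
      have "((\<lambda>t. exp (- 2 * k * t)) has_real_derivative exp (- 2 * k * t) * (- 2 * k)) (at t)"
        by (auto intro!: derivative_eq_intros)
      from DERIV_mult[OF this DERIV_norm_square[OF der[OF t]]]
      show ?thesis by (simp add: v_def algebra_simps)
    qed
    moreover have "exp (- 2 * k * t) * (2 * (y t \<bullet> d t)) + (exp (- 2 * k * t) * (- 2 * k)) * (norm (y t))\<^sup>2
        = 2 * exp (- 2 * k * t) * (y t \<bullet> d t - k * (norm (y t))\<^sup>2)"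
      by (simp add: algebra_simps)
    ultimately show "\<exists>w. (v has_real_derivative w) (at t) \<and> w \<le> 0"
      using le[OF t] by (auto simp: mult_le_0_iff)
  next
    show "continuous_on {a..b} v" unfolding v_def by (intro continuous_intros cont)
  qed
  then have "exp (2 * k * b) * v b \<le> exp (2 * k * b) * v a" by simp
  moreover have "exp (2 * k * b) * v s = exp (2 * (k * (b - s))) * (norm (y s))\<^sup>2" for s
    by (simp add: v_def mult.assoc[symmetric] exp_add[symmetric]) (simp add: algebra_simps)
  moreover have "exp (2 * (k * (b - a))) = (exp (k * (b - a)))\<^sup>2"
    by (rule exp_double)
  ultimately have "(norm (y b))\<^sup>2 \<le> (exp (k * (b - a)) * norm (y a))\<^sup>2"
    by (simp add: power_mult_distrib)
  then show ?thesis by (rule power2_le_imp_le) simp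
qed

text \<open>The second bound is the first for the reversed curve s -> z (t - s), which solves the
  equation of -L. It keeps a nonzero solution away from 0, so that negative powers of its norm stay
  continuous.\<close>

lemma linear_ode_bounds:
  fixes L :: "'a::real_inner \<Rightarrow> 'a"
  assumes L: "\<And>x. norm (L x) \<le> k * norm x"
    and der: "\<And>t. (z has_vector_derivative L (z t)) (at t)"
    and "0 \<le> t"
  shows "norm (z t) \<le> exp (k * t) * norm (z 0)" "norm (z 0) \<le> exp (k * t) * norm (z t)"
proof -
  have cont: "continuous_on UNIV z"
    by (meson continuous_at_imp_continuous_on der has_vector_derivative_continuous)
  have bound: "\<bar>v \<bullet> L v\<bar> \<le> k * (norm v)\<^sup>2" for v
    using Cauchy_Schwarz_ineq2[of v "L v"] mult_left_mono[OF L[of v], of "norm v"]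
    by (simp add: power2_eq_square mult_ac)
  show "norm (z t) \<le> exp (k * t) * norm (z 0)"
    using gronwall_norm_square[OF \<open>0 \<le> t\<close> continuous_on_subset[OF cont] der, of k]
      abs_le_D1[OF bound] by simp
  have der': "((\<lambda>s. z (t - s)) has_vector_derivative - L (z (t - s))) (at s)" for s
  proof -
    have "((\<lambda>s. t - s) has_vector_derivative -1) (at s)"
      by (auto intro!: derivative_eq_intros)
    from vector_diff_chain_at[OF this der] show ?thesis by (simp add: o_def)
  qed
  have "continuous_on {0..t} (\<lambda>s. z (t - s))"
    by (intro continuous_on_compose2[OF cont] continuous_intros) auto
  from gronwall_norm_square[OF \<open>0 \<le> t\<close> this der', of k] abs_le_D2[OF bound]
  show "norm (z 0) \<le> exp (k * t) * norm (z t)" by simp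
qed

section \<open>Monotonicity and forward uniqueness\<close>

text \<open>By Cauchy-Schwarz the inner product is at least (|x|^\<alpha> - |y|^\<alpha>) (|x| -
  |y|), whose two factors have the same sign as powers with positive exponent increase.\<close>

lemma norm_scaled_monotone:
  fixes x y :: "'a::real_inner"
  assumes "0 < \<alpha>"
  shows "0 \<le> (norm_scaled \<alpha> x - norm_scaled \<alpha> y) \<bullet> (x - y)"
proof -
  have pw: "norm v powr (\<alpha> - 1) * norm v = norm v powr \<alpha>" for v :: 'a
    by (cases "v = 0") (simp_all add: powr_diff)
  have "norm v powr (\<alpha> - 1) * (x \<bullet> y) \<le> norm v powr (\<alpha> - 1) * (norm x * norm y)" for v :: 'a
    by (intro mult_left_mono norm_cauchy_schwarz) simp
  from this[of x] this[of y]
  have "(norm x powr (\<alpha> - 1) + norm y powr (\<alpha> - 1)) * (x \<bullet> y)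
      \<le> norm x powr \<alpha> * norm y + norm y powr \<alpha> * norm x"
    by (simp add: pw[symmetric] algebra_simps)
  moreover have "(norm_scaled \<alpha> x - norm_scaled \<alpha> y) \<bullet> (x - y) =
      norm x powr \<alpha> * norm x + norm y powr \<alpha> * norm y
      - (norm x powr (\<alpha> - 1) + norm y powr (\<alpha> - 1)) * (x \<bullet> y)"
    by (simp add: norm_scaled_def pw[symmetric] inner_diff_left inner_diff_right
        inner_commute[of y x] dot_square_norm power2_eq_square algebra_simps)
  moreover have "0 \<le> (norm x powr \<alpha> - norm y powr \<alpha>) * (norm x - norm y)"
    using powr_mono2[of \<alpha> "norm x" "norm y"] powr_mono2[of \<alpha> "norm y" "norm x"] assms
    by (cases "norm x \<le> norm y") (auto intro: mult_nonneg_nonneg mult_nonpos_nonpos)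
  ultimately show ?thesis by (simp add: algebra_simps)
qed

text \<open>The one-sided Lipschitz bound is the Gronwall hypothesis for the difference of two
  solutions, which starts at 0 and therefore stays there.\<close>

lemma forward_solution_unique:
  fixes f :: "'a::euclidean_space \<Rightarrow> 'a"
  assumes osl: "\<And>v w. (f v - f w) \<bullet> (v - w) \<le> k * (norm (v - w))\<^sup>2"
    and 1: "forward_solution D f x J1 y1" and 2: "forward_solution D f x J2 y2"
    and t: "t \<in> J1" "t \<in> J2"
  shows "y1 t = y2 t"
proof -
  have "0 \<le> t" using 1 t by (auto simp: forward_solution_def)
  have sub: "{0..t} \<subseteq> J \<and> continuous_on {0..t} y \<and>
      (\<forall>s. 0 < s \<longrightarrow> s < t \<longrightarrow> (y has_vector_derivative f (y s)) (at s))"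
    if sol: "forward_solution D f x J y" and tJ: "t \<in> J" for J y
  proof -
    from sol have J: "is_interval J" "0 \<in> J"
      and der: "\<And>s. s \<in> J \<Longrightarrow> (y has_vector_derivative f (y s)) (at s within J)"
      by (auto simp: forward_solution_def)
    have sub: "{0..t} \<subseteq> J"
      using mem_is_interval_1_I[OF J tJ] by auto
    have "continuous_on J y"
      using der by (meson continuous_on_eq_continuous_within has_vector_derivative_continuous)
    then have "continuous_on {0..t} y" using sub continuous_on_subset by blast
    moreover have "(y has_vector_derivative f (y s)) (at s)" if "0 < s" "s < t" for s
    proof -
      \<comment> \<open>Restricting to an open interval around s turns the derivative within
        \<open>J\<close> into a two-sided one.\<close>
      have "(y has_vector_derivative f (y s)) (at s within {0<..<t})"
        using that sub by (intro has_vector_derivative_within_subset[OF der]) auto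
      then show ?thesis using that at_within_open[of s "{0<..<t}"] by simp
    qed
    ultimately show ?thesis using sub by blast
  qed
  have "norm (y1 t - y2 t) \<le> exp (k * (t - 0)) * norm (y1 0 - y2 0)"
  proof (rule gronwall_norm_square[OF \<open>0 \<le> t\<close>])
    show "continuous_on {0..t} (\<lambda>s. y1 s - y2 s)"
      using sub[OF 1 t(1)] sub[OF 2 t(2)] by (intro continuous_intros) auto
    show "((\<lambda>s. y1 s - y2 s) has_vector_derivative f (y1 s) - f (y2 s)) (at s)"
      if "0 < s" "s < t" for s
      using sub[OF 1 t(1)] sub[OF 2 t(2)] that by (intro derivative_intros) auto
    show "(y1 s - y2 s) \<bullet> (f (y1 s) - f (y2 s)) \<le> k * (norm (y1 s - y2 s))\<^sup>2" for s
      using osl[of "y1 s" "y2 s"] by (simp add: inner_commute)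
  qed
  then show ?thesis using 1 2 by (simp add: forward_solution_def)
qed

lemma forward_solution_atLeast:
  assumes "y 0 = x" "\<And>t. 0 \<le> t \<Longrightarrow> (y has_vector_derivative f (y t)) (at t within {0..})"
  shows "forward_solution UNIV f x {0..} y"
proof -
  have "(1::real) \<in> {0..}" by simp
  then have "{0::real..} \<noteq> {0}" by (metis singletonD zero_neq_one)
  then show ?thesis using assms is_interval_ci by (simp add: forward_solution_def)
qed

text \<open>By forward uniqueness the global solution extends every other solution, so a maximal one
  must already have the whole half-line as its domain.\<close>

lemma global_solution_unique_right_maximal:
  fixes f :: "'a::euclidean_space \<Rightarrow> 'a"
  assumes osl: "\<And>v w. (f v - f w) \<bullet> (v - w) \<le> k * (norm (v - w))\<^sup>2"
    and sol: "forward_solution D f x {0..} y"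
  shows "unique_right_maximal_solution D f x {0..} y"
proof -
  have sub: "J \<subseteq> {0..}" if "forward_solution D f x J y'" for J y'
    using that by (simp add: forward_solution_def)
  have eq: "y' t = y t" if "forward_solution D f x J y'" "t \<in> J" for J y' t
    using forward_solution_unique[OF osl that(1) sol that(2)] sub[OF that(1)] that(2) by blast
  have max: "right_maximal_solution D f x {0..} y"
    unfolding right_maximal_solution_def using sol sub by blast
  moreover have "J = {0..}" if "right_maximal_solution D f x J y'" for J y'
    using that sol sub[of J y'] eq[of J y'] unfolding right_maximal_solution_def by metis
  moreover have "y' t = y t" if "right_maximal_solution D f x {0..} y'" "t \<in> {0..}" for y' t
    using that eq[of "{0..}" y' t] unfolding right_maximal_solution_def by blast
  ultimately show ?thesis
    unfolding unique_right_maximal_solution_def by blast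
qed

section \<open>Explicit solution of the closed loop\<close>

text \<open>At 0 the difference quotient is bounded by |h|^(p-1), which vanishes as p > 1. This
  makes the cut-off scalar factor differentiable even at the instant when the trajectory reaches the
  origin.\<close>

lemma DERIV_pos_part_powr:
  fixes p :: real
  assumes "1 < p"
  shows "((\<lambda>s. max 0 s powr p) has_real_derivative p * max 0 s powr (p - 1)) (at s)"
proof (cases s "0 :: real" rule: linorder_cases)
  case less
  have "((\<lambda>s. 0) has_real_derivative 0) (at s)" by simp
  moreover have "eventually (\<lambda>r. r < 0) (nhds s)"
    using less eventually_nhds_in_open[of "{..<0}" s] by simp
  then have "eventually (\<lambda>r. 0 = max 0 r powr p) (nhds s)"
    by eventually_elim simp
  ultimately show ?thesis using less
    by (subst DERIV_cong_ev[OF refl, where g="\<lambda>_. 0"]) (auto elim: eventually_mono)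
next
  case equal
  have "((\<lambda>h. max 0 h powr p / h) \<longlongrightarrow> 0) (at 0)"
  proof (rule Lim_null_comparison)
    have "norm (max 0 h powr p / h) \<le> \<bar>h\<bar> powr (p - 1)" for h :: real
    proof (cases "h > 0")
      case True
      then show ?thesis by (simp add: powr_diff)
    next
      case False
      then have "max 0 h = 0" by simp
      then show ?thesis by simp
    qed
    then show "\<forall>\<^sub>F h in at 0. norm (max 0 h powr p / h) \<le> \<bar>h\<bar> powr (p - 1)" by simp
    show "((\<lambda>h::real. \<bar>h\<bar> powr (p - 1)) \<longlongrightarrow> 0) (at 0)"
      using assms by (intro tendsto_zero_powrI tendsto_rabs_zero tendsto_ident_at tendsto_const) auto
  qed
  then show ?thesis using equal by (simp add: DERIV_def)
next
  case greater
  have "((\<lambda>s. s powr p) has_real_derivative p * s powr (p - 1)) (at s)"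
    using greater by (auto intro!: derivative_eq_intros simp: powr_diff)
  moreover have "eventually (\<lambda>r. r > 0) (nhds s)"
    using greater eventually_nhds_in_open[of "{0<..}" s] by simp
  ultimately show ?thesis using greater
    by (subst DERIV_cong_ev[OF refl, where g="\<lambda>s. s powr p"]) (auto elim: eventually_mono)
qed

lemma antiderivative_atLeast:
  fixes h :: "real \<Rightarrow> real"
  assumes "continuous_on {0..} h"
  shows "\<exists>G. G 0 = 0 \<and> (\<forall>t\<ge>0. (G has_real_derivative h t) (at t within {0..}))"
proof (intro exI[of _ "\<lambda>t. integral {0..t} h"] conjI allI impI)
  fix t :: real assume "0 \<le> t"
  have "((\<lambda>t. integral {0..t} h) has_real_derivative h t) (at t within {0..t+1})"
    using \<open>0 \<le> t\<close> by (intro integral_has_real_derivative continuous_on_subset[OF assms]) auto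
  moreover have "at t within {0..t+1} = at t within {0..}"
    by (rule at_within_nhd[of t "{..<t+1}"]) auto
  ultimately show "((\<lambda>t. integral {0..t} h) has_real_derivative h t) (at t within {0..})"
    by (simp only:)
qed simp

text \<open>The smallness condition says k |x| < |x|^\<alpha>: initially the radial damping beats
  the largest growth that \<open>L\<close> allows. It guarantees extinction; the global solution
  exists for larger x as well.\<close>

lemma closed_loop_solution:
  fixes L :: "'a::euclidean_space \<Rightarrow> 'a"
  assumes "bounded_linear L" and L: "\<And>x. norm (L x) \<le> k * norm x" and "0 < k"
    and "0 < \<alpha>" "\<alpha> < 1" and "x \<noteq> 0"
  shows "\<exists>y. forward_solution UNIV (\<lambda>x. L x - norm_scaled \<alpha> x) x {0..} y \<and>
    (k * norm x powr (1 - \<alpha>) < 1 \<longrightarrow>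
      (\<exists>T>0. y T = 0 \<and> (\<forall>t\<in>{0..<T}. y t \<noteq> 0 \<and> norm (y t) \<le> norm x)))"
proof -
  interpret L: bounded_linear L by fact
  obtain z where z0: "z 0 = x" and z: "\<And>t. (z has_vector_derivative L (z t)) (at t)"
    using linear_ode_solution_exists[OF \<open>bounded_linear L\<close>] by metis
  define q r where "q = 1 - \<alpha>" and "r = norm x"
  have q: "0 < q" "q < 1" and r: "0 < r"
    using assms by (auto simp: q_def r_def)
  note bounds = linear_ode_bounds[OF L z, unfolded z0, folded r_def]
  have z_nz: "z t \<noteq> 0" if "0 \<le> t" for t
    using bounds(2)[OF that] r by auto
  have z_cont: "continuous_on S z" for S
    by (meson continuous_at_imp_continuous_on z has_vector_derivative_continuous)
  have "continuous_on {0..} (\<lambda>t. norm (z t) powr (- q))"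
    using z_nz by (intro continuous_intros z_cont) auto
  from antiderivative_atLeast[OF this] obtain G where G0: "G 0 = 0"
    and G: "\<And>t. 0 \<le> t \<Longrightarrow> (G has_real_derivative norm (z t) powr (- q)) (at t within {0..})"
    by blast
  \<comment> \<open>\<open>g\<close> is the power c^q given by separation of variables, before it is
    cut off at 0.\<close>
  define g where "g = (\<lambda>t. 1 - q * G t)"
  define c where "c = (\<lambda>t. max 0 (g t) powr (1 / q))"
  define y where "y = (\<lambda>t. c t *\<^sub>R z t)"
  have g: "(g has_real_derivative - q * norm (z t) powr (- q)) (at t within {0..})" if "0 \<le> t" for t
    unfolding g_def by (auto intro!: derivative_eq_intros G that)
  have g0: "g 0 = 1" by (simp add: g_def G0)
  have c_deriv: "(c has_real_derivative - (c t powr \<alpha> * norm (z t) powr (- q))) (at t within {0..})"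
    if "0 \<le> t" for t
  proof -
    have "(c has_real_derivative 1 / q * max 0 (g t) powr (1 / q - 1) * (- q * norm (z t) powr (- q)))
        (at t within {0..})"
      unfolding c_def using q by (intro DERIV_chain2[OF DERIV_pos_part_powr g] that) simp
    \<comment> \<open>The exponents agree because 1 / q - 1 = \<alpha> / q for q = 1 -
      \<alpha>.\<close>
    moreover have "c t powr \<alpha> = max 0 (g t) powr (1 / q - 1)"
      using q by (simp add: c_def powr_powr q_def field_simps)
    ultimately show ?thesis using q by simp
  qed
  have ns: "norm_scaled \<alpha> (y t) = (c t powr \<alpha> * norm (z t) powr (- q)) *\<^sub>R z t" for t
  proof (cases "c t = 0")
    case False
    then have "0 < c t" by (simp add: c_def)
    then show ?thesis
      by (simp add: norm_scaled_def y_def q_def powr_mult powr_diff)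
  qed (simp add: norm_scaled_def y_def)
  have y_deriv: "(y has_vector_derivative L (y t) - norm_scaled \<alpha> (y t)) (at t within {0..})"
    if "0 \<le> t" for t
  proof -
    have "(y has_vector_derivative c t *\<^sub>R L (z t) + (- (c t powr \<alpha> * norm (z t) powr (- q))) *\<^sub>R z t)
        (at t within {0..})"
      unfolding y_def
      by (intro has_vector_derivative_scaleR c_deriv that has_vector_derivative_at_within[OF z])
    then show ?thesis unfolding ns by (simp add: y_def L.scaleR)
  qed
  have y0: "y 0 = x" by (simp add: y_def c_def g0 z0)
  have sol: "forward_solution UNIV (\<lambda>x. L x - norm_scaled \<alpha> x) x {0..} y"
    by (rule forward_solution_atLeast[OF y0 y_deriv])
  have g_cont: "continuous_on {0..t} g" for t
  proof -
    have "continuous_on {0..} g"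
      using g by (meson DERIV_continuous_on atLeast_iff)
    then show ?thesis by (rule continuous_on_subset) auto
  qed
  have g_int: "(g has_real_derivative - q * norm (z t) powr (- q)) (at t)" if "0 < t" for t
  proof -
    have "(g has_real_derivative - q * norm (z t) powr (- q)) (at t within {0<..})"
      using that by (intro has_field_derivative_subset[OF g]) auto
    then show ?thesis using that at_within_open[of t "{0<..}"] by simp
  qed
  \<comment> \<open>This is the bound |z(s)| \<le> exp (ks) r put into the integral defining
    \<open>G\<close> and integrated explicitly; comparing derivatives through \<open>w\<close>
    replaces the comparison of integrals.\<close>
  have g_upper: "g t \<le> 1 - r powr (- q) * (1 - exp (- k * q * t)) / k" if "0 \<le> t" for t
  proof -
    define w where "w = (\<lambda>t. g t + r powr (- q) * (1 - exp (- k * q * t)) / k)"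
    have "w t \<le> w 0"
    proof (rule DERIV_nonpos_imp_decreasing_open[OF that])
      fix s assume s: "0 < s" "s < t"
      have "(w has_real_derivative - q * norm (z s) powr (- q) + r powr (- q) * (q * exp (- k * q * s))) (at s)"
        unfolding w_def using \<open>0 < k\<close> by (auto intro!: derivative_eq_intros g_int s)
      moreover have "r powr (- q) * exp (- k * q * s) = (exp (k * s) * r) powr (- q)"
        using r by (simp add: powr_mult exp_powr_real mult_ac)
      moreover have "(exp (k * s) * r) powr (- q) \<le> norm (z s) powr (- q)"
        using bounds(1)[of s] z_nz[of s] s q by (intro powr_mono2') auto
      ultimately show "\<exists>d. (w has_real_derivative d) (at s) \<and> d \<le> 0"
        using q by (intro exI conjI) (assumption, simp add: algebra_simps)
    next
      show "continuous_on {0..t} w" unfolding w_def by (intro continuous_intros g_cont) (use \<open>0<k\<close> in auto)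
    qed
    then show ?thesis by (simp add: w_def g0)
  qed
  have "\<exists>T>0. y T = 0 \<and> (\<forall>t\<in>{0..<T}. y t \<noteq> 0 \<and> norm (y t) \<le> r)" if small: "k * r powr q < 1"
  proof -
    have k_less: "k < r powr (- q)"
      using small r by (simp add: powr_minus field_simps)
    \<comment> \<open>\<open>t1\<close> is the zero of the upper bound \<open>g_upper\<close>;
      smallness makes the argument of the logarithm positive.\<close>
    define t1 where "t1 = - ln (1 - k * r powr q) / (k * q)"
    have pos: "0 < k * r powr q" using \<open>0 < k\<close> r by simp
    have t1: "0 \<le> t1" using pos small q \<open>0 < k\<close> by (simp add: t1_def divide_nonpos_pos)
    have "exp (- k * q * t1) = 1 - k * r powr q"
      using small q \<open>0 < k\<close> by (simp add: t1_def)
    then have "g t1 \<le> 1 - r powr (- q) * (k * r powr q) / k" using g_upper[OF t1] by simp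
    also have "\<dots> = 0" using \<open>0 < k\<close> r by (simp add: powr_minus)
    finally have "g t1 \<le> 0" .
    with IVT2'[OF _ _ t1 g_cont, of 0] g0 obtain T where T: "0 \<le> T" "g T = 0" by auto
    with g0 have "0 < T" by (cases "T = 0") auto
    moreover have "y T = 0" by (simp add: y_def c_def T)
    moreover have "y t \<noteq> 0 \<and> norm (y t) \<le> r" if t: "0 \<le> t" "t < T" for t
    proof -
      \<comment> \<open>Strict decrease of \<open>g\<close> makes \<open>T\<close> its first zero,
        so the trajectory is nonzero before \<open>T\<close>.\<close>
      have "g T < g t"
      proof (rule DERIV_neg_imp_decreasing_open[OF t(2)])
        show "continuous_on {t..T} g" by (rule continuous_on_subset[OF g_cont[of T]]) (use t in auto)
        show "\<exists>d. (g has_real_derivative d) (at s) \<and> d < 0" if "t < s" "s < T" for s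
        proof (intro exI conjI)
          show "(g has_real_derivative - q * norm (z s) powr (- q)) (at s)"
            using that t by (intro g_int) simp
          show "- q * norm (z s) powr (- q) < 0"
            using that t q z_nz[of s] by simp
        qed
      qed
      with T have gt: "0 < g t" by simp
      define E where "E = exp (- k * q * t)"
      have E: "E \<le> 1" using \<open>0 < k\<close> q t by (simp add: E_def)
      \<comment> \<open>Smallness gives r^(-q) / k > 1, hence g \<le> E and c \<le> exp (-kt), which
        exactly cancels the possible growth exp (kt) of \<open>z\<close>.\<close>
      have "(1 - E) * 1 \<le> (1 - E) * (r powr (- q) / k)"
        using k_less \<open>0 < k\<close> E by (intro mult_left_mono) auto
      with g_upper[OF t(1)] have "g t \<le> E" by (simp add: E_def mult_ac)
      then have "c t \<le> E powr (1 / q)"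
        unfolding c_def using gt q by (intro powr_mono2) auto
      also have "\<dots> = exp (- k * t)" using q by (simp add: E_def exp_powr_real)
      finally have "c t * norm (z t) \<le> exp (- k * t) * (exp (k * t) * r)"
        using bounds(1)[OF t(1)] by (intro mult_mono) auto
      also have "\<dots> = r" by (simp add: mult.assoc[symmetric] exp_add[symmetric])
      finally have "c t * norm (z t) \<le> r" .
      then show ?thesis using gt z_nz[OF t(1)] by (simp add: y_def c_def)
    qed
    ultimately show ?thesis by auto
  qed
  with sol show ?thesis unfolding q_def r_def by blast
qed

section \<open>Finite-time stability\<close>

text \<open>One bound k on \<open>L\<close> serves both as one-sided Lipschitz constant, for
  uniqueness, and as growth rate, for extinction. Since norms never exceed their initial value up to
  extinction, small balls give both the invariant neighborhood and stability.\<close>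

lemma finite_time_stable_linear_minus_norm_scaled:
  fixes L :: "'a::euclidean_space \<Rightarrow> 'a"
  assumes "bounded_linear L" and \<alpha>: "0 < \<alpha>" "\<alpha> < 1"
  shows "finite_time_stable_origin UNIV (\<lambda>x. L x - norm_scaled \<alpha> x)"
proof -
  interpret L: bounded_linear L by fact
  obtain k where k: "0 < k" and Lk: "\<And>x. norm (L x) \<le> k * norm x"
    using L.pos_bounded by (metis mult.commute)
  define f where "f = (\<lambda>x. L x - norm_scaled \<alpha> x)"
  have f0: "f 0 = 0" by (simp add: f_def norm_scaled_def L.zero)
  have osl: "(f v - f w) \<bullet> (v - w) \<le> k * (norm (v - w))\<^sup>2" for v w
  proof -
    have "L (v - w) \<bullet> (v - w) \<le> norm (L (v - w)) * norm (v - w)" by (rule norm_cauchy_schwarz)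
    also have "\<dots> \<le> k * norm (v - w) * norm (v - w)" by (intro mult_right_mono Lk) auto
    finally show ?thesis
      using norm_scaled_monotone[OF \<alpha>(1), of v w]
      by (simp add: f_def L.diff power2_eq_square inner_diff_left mult_ac)
  qed
  \<comment> \<open>Trajectory and extinction time are bundled so that they can be chosen together
    for every x; at 0 and for large x the value of \<open>T\<close> is arbitrary.\<close>
  define P where "P = (\<lambda>x y T. forward_solution UNIV f x {0..} y \<and>
      (x \<noteq> 0 \<and> k * norm x powr (1 - \<alpha>) < 1 \<longrightarrow>
        T > 0 \<and> y T = 0 \<and> (\<forall>t\<in>{0..<T}. y t \<noteq> 0 \<and> norm (y t) \<le> norm x)))"
  have "\<exists>y T. P x y T" for x
  proof (cases "x = 0")
    case True
    have "forward_solution UNIV f x {0..} (\<lambda>_. 0)"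
      using True f0 by (intro forward_solution_atLeast) simp_all
    then show ?thesis using True by (auto simp: P_def)
  next
    case False
    from closed_loop_solution[OF \<open>bounded_linear L\<close> Lk k \<alpha> False]
    show ?thesis unfolding P_def f_def by blast
  qed
  then obtain \<psi> T where P: "\<And>x. P x (\<psi> x) (T x)" by metis
  \<comment> \<open>The radius solves k r^(1-\<alpha>) = 1, so the ball is exactly the region of
    small initial values.\<close>
  define N :: "'a set" where "N = ball 0 ((1 / k) powr (1 / (1 - \<alpha>)))"
  have N: "k * norm x powr (1 - \<alpha>) < 1" if "x \<in> N" for x
  proof -
    have "norm x powr (1 - \<alpha>) < ((1 / k) powr (1 / (1 - \<alpha>))) powr (1 - \<alpha>)"
      using that \<alpha> by (intro powr_less_mono2) (auto simp: N_def)
    then show ?thesis using \<alpha> k by (simp add: powr_powr field_simps)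
  qed
  have sol: "forward_solution UNIV f x {0..} (\<psi> x)" for x
    using P by (simp add: P_def)
  have hit: "T x > 0" "\<psi> x (T x) = 0" "\<And>t. t \<in> {0..<T x} \<Longrightarrow> \<psi> x t \<noteq> 0 \<and> norm (\<psi> x t) \<le> norm x"
    if "x \<in> N - {0}" for x
    using P[of x] N[of x] that by (auto simp: P_def)
  have lim: "(\<psi> x \<longlongrightarrow> 0) (at_left (T x))" if x: "x \<in> N - {0}" for x
  proof -
    have "(\<psi> x has_vector_derivative f (\<psi> x (T x))) (at (T x) within {0..})"
      using sol[of x] hit(1)[OF x] by (simp add: forward_solution_def)
    \<comment> \<open>As \<open>T x\<close> is positive, it is interior to the half-line; the
      solution is continuous there, and its left limit is its value 0.\<close>
    then have "(\<psi> x has_vector_derivative f (\<psi> x (T x))) (at (T x) within {0<..})"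
      by (rule has_vector_derivative_within_subset) auto
    then have "continuous (at (T x)) (\<psi> x)"
      using hit(1)[OF x] at_within_open[of "T x" "{0<..}"]
      by (auto intro: has_vector_derivative_continuous)
    then show ?thesis
      using hit(2)[OF x] by (metis continuous_at continuous_within filterlim_at_split)
  qed
  have "\<exists>V. open V \<and> V \<subseteq> N \<and> 0 \<in> V \<and> (\<forall>x\<in>V - {0}. \<forall>t\<in>{0..<T x}. \<psi> x t \<in> U)"
    if U: "open U" "0 \<in> U" for U
  proof -
    obtain e where e: "0 < e" "ball 0 e \<subseteq> U" using U open_contains_ball by blast
    have "\<psi> x t \<in> U" if "x \<in> N \<inter> ball 0 e - {0}" "t \<in> {0..<T x}" for x t
      using hit(3)[of x t] that e by (force simp: subset_iff)
    then show ?thesis using e k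
      by (intro exI[of _ "N \<inter> ball 0 e"]) (auto simp: N_def)
  qed
  moreover have "\<psi> x t \<in> N - {0}" if "x \<in> N - {0}" "t \<in> {0..<T x}" for x t
    using hit(3)[OF that] that(1) by (auto simp: N_def)
  moreover have "open N" "0 \<in> N" using k by (auto simp: N_def)
  ultimately have "finite_time_stable_origin UNIV f"
    unfolding finite_time_stable_origin_def
    using f0 hit(1) lim global_solution_unique_right_maximal[OF osl sol]
    by (intro conjI exI[of _ "\<lambda>_. {0..}"] exI[of _ \<psi>] exI[of _ N] exI[of _ T]) auto
  then show ?thesis by (simp add: f_def)
qed

theorem theorem6:
  fixes A B K1 K2 :: "real^'n^'n"
    and u :: "real^'n \<Rightarrow> real^'n"
    and \<alpha> :: real
  assumes "rank B = CARD('n)"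
    and "0 < \<alpha>" and "\<alpha> < 1"
    and "hurwitz (A + B ** K1)"
    and "K2 = - matrix_inv B"
    and "\<And>x. u x = K1 *v x + K2 *v norm_scaled \<alpha> x"
  shows "finite_time_stable_origin UNIV (\<lambda>x. A *v x + B *v u x)"
proof -
  have "invertible B"
    using assms(1) full_rank_surjective[of B] matrix_right_invertible_surjective[of B]
    by (auto simp: invertible_right_inverse)
  \<comment> \<open>\<open>matrix_inv\<close> is a choice of two-sided inverse, so its defining
    equation is available only after invertibility, which comes from the full rank.\<close>
  then have "B ** matrix_inv B = mat 1"
    unfolding invertible_def matrix_inv_def by (metis (mono_tags, lifting) someI_ex)
  then have "B *v (matrix_inv B *v v) = v" for v
    by (metis matrix_vector_mul_assoc matrix_vector_mul_lid)
  moreover have "(- matrix_inv B) *v v = - (matrix_inv B *v v)" for v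
    using matrix_vector_mult_diff_rdistrib[of 0 "matrix_inv B" v] by simp
  \<comment> \<open>\<open>K2\<close> is chosen so that B K2 = -I, which feeds the nonlinear term
    into the dynamics as pure radial damping.\<close>
  ultimately have "A *v x + B *v u x = (A + B ** K1) *v x - norm_scaled \<alpha> x" for x
    by (simp add: assms(5,6) matrix_vector_mult_add_rdistrib matrix_vector_mul_assoc[symmetric]
        matrix_vector_mult_diff_distrib)
  then show ?thesis
    using finite_time_stable_linear_minus_norm_scaled[OF matrix_vector_mul_bounded_linear assms(2,3),
        of "A + B ** K1"] by simp
qed

end
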